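(* Consider the nonlinear system $\mathbf{x}_{k+1}=\boldsymbol{f}(\mathbf{x}_k,\mathbf{u}_k)$, $\mathbf{y}_k=\boldsymbol{h}(\mathbf{x}_k)$ described in the context, with relative degrees $d_1,\dots,d_m$, and suppose that Assumptions 1-4 listed in the context are satisfied. Consider the nominal case, i.e., the basis functions represent the unknown function exactly, $\Phi(\mathbf{u},\Xi)=\mathcal{G}\Psi(\mathbf{u},\Xi)$ (the approximation error $\epsilon$ is identically zero), and the output data are noiseless. Let $\{\mathbf{u}_k\}_{k=0}^{N-1}$, $\{y_{i,k}\}_{k=0}^{N+d_i-1}$, $i=1,\dots,m$, be a trajectory of the nonlinear system, let $\Xi_k=\begin{bmatrix} y_{1,[k,k+d_1-1]}^\top & \cdots & y_{m,[k,k+d_m-1]}^\top\end{bmatrix}^\top$ for $k=0,\dots,N$, and let $\hat\Psi_k(\mathbf{u},\Xi)=\Psi(\mathbf{u}_k,\Xi_k)$ for $k=0,\dots,N-1$. Suppose that the sequence $\{\hat\Psi_k(\mathbf{u},\Xi)\}_{k=0}^{N-1}$ is persistently exciting of order $L+n$. Then any $\{\bar{\mathbf{u}}_k\}_{k=0}^{L-1}$, $\{\bar y_{i,k}\}_{k=0}^{L+d_i-1}$, $i=1,\dots,m$, is a trajectory of the nonlinear system if and only if there exists $\alpha\in\mathbb{R}^{N-L+1}$ such that $$\begin{bmatrix} H_L(\hat\Psi(\mathbf{u},\Xi))\\ H_{L+1}(\Xi)\end{bmatrix}\alpha=\begin{bmatrix}\hat\Psi(\bar{\mathbf{u}},\bar\Xi)\\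 \bar\Xi\end{bmatrix},$$ where $\hat\Psi(\mathbf{u},\Xi)$ denotes the data sequence $\{\hat\Psi_k(\mathbf{u},\Xi)\}_{k=0}^{N-1}$, $\hat\Psi(\bar{\mathbf{u}},\bar\Xi)$ is the stacked vector of $\{\Psi(\bar{\mathbf{u}}_k,\bar\Xi_k)\}_{k=0}^{L-1}$, and $\Xi,\bar\Xi$ are the stacked vectors of $\{\Xi_k\}_{k=0}^{N}$ and $\{\bar\Xi_k\}_{k=0}^{L}$, with $\bar\Xi_k=\begin{bmatrix} \bar y_{1,[k,k+d_1-1]}^\top & \cdots & \bar y_{m,[k,k+d_m-1]}^\top\end{bmatrix}^\top$.
   Context: Notation. For a sequence $\{\mathbf{z}_k\}_{k=0}^{N-1}$ with $\mathbf{z}_k\in\mathbb{R}^\eta$, $\mathbf{z}=[\mathbf{z}_0^\top\ \cdots\ \mathbf{z}_{N-1}^\top]^\top$ is its stacked vector, $\mathbf{z}_{[a,b]}=[\mathbf{z}_a^\top\ \cdots\ \mathbf{z}_b^\top]^\top$ is a window of it, and the depth-$L$ Hankel matrix $H_L(\mathbf{z})\in\mathbb{R}^{\eta L\times(N-L+1)}$ has as its $j$-th column ($j=0,\dots,N-L$) the vector $\mathbf{z}_{[j,j+L-1]}$. The sequence is persistently exciting of order $L$ if $\operatorname{rank}H_L(\mathbf{z})=\eta L$. System. $\mathbf{x}_{k+1}=\boldsymbol{f}(\mathbf{x}_k,\mathbf{u}_k)$, $\mathbf{y}_k=\boldsymbol{h}(\mathbf{x}_k)$ with $\mathbf{x}_k\in\mathbb{R}^n$,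 $\mathbf{u}_k,\mathbf{y}_k\in\mathbb{R}^m$, where $\boldsymbol{f}:\mathbb{R}^n\times\mathbb{R}^m\to\mathbb{R}^n$ and $\boldsymbol{h}=(h_1,\dots,h_m):\mathbb{R}^n\to\mathbb{R}^m$ are analytic, $\boldsymbol{f}(\mathbf{0},\mathbf{0})=\mathbf{0}$, $\boldsymbol{h}(\mathbf{0})=\mathbf{0}$. Let $\boldsymbol{f}_O^j$ be the $j$-th iterated composition of $\boldsymbol{f}_O=\boldsymbol{f}(\cdot,\mathbf{0})$. Each output $y_i$ has a globally well-defined relative degree $d_i\ge 1$: $d_i$ is the first delay at which at least one input at time $k$ affects output $i$, so that $y_{i,k},\dots,y_{i,k+d_i-1}$ do not depend on $\mathbf{u}_k,\mathbf{u}_{k+1},\dots$ (they are functions of $\mathbf{x}_k$), and $y_{i,k+d_i}=h_i(\boldsymbol{f}_O^{d_i-1}(\boldsymbol{f}(\mathbf{x}_k,\mathbf{u}_k)))$. An input-output sequence is a trajectory of the system if there is an initial condition $\mathbf{x}_0$ for which the system equations produce it; for inputs $\{\mathbf{u}_k\}_{k=0}^{N-1}$, the outputs $y_{i,k}$ with $0\le k\le N+d_i-1$ are determined by $\mathbf{x}_0$ and these inputs. Assumption 1: for any $\mathbf{x}_k\in\mathbb{R}^n$ there is $\tilde{\mathbf{u}}_k\in\mathbb{R}^m$ with $h_i(\boldsymbol{f}_O^{d_i-1}(\boldsymbol{f}(\mathbf{x}_k,\tilde{\mathbf{u}}_k)))=0$ for all $i=1,\dots,m$. Assumption 2: for any $\mathbf{x}_k\in\mathbb{R}^n$,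 the decoupling matrix $\mathcal{D}(\mathbf{x}_k,\mathbf{u}_k)$ with entries $\partial h_i(\boldsymbol{f}_O^{d_i-1}(\boldsymbol{f}(\mathbf{x}_k,\mathbf{u}_k)))/\partial u_{j,k}$, evaluated at $\mathbf{u}_k=\tilde{\mathbf{u}}_k$, has rank $m$. Assumption 3: $\sum_{i=1}^m d_i=n$. Under Assumptions 1-3 it is a known result (Monaco and Normand-Cyrot), which may be used, that there exist an invertible coordinate transformation $\Xi_k=T(\mathbf{x}_k)$ on $\mathbb{R}^n$, where $\Xi_k=[y_{1,[k,k+d_1-1]}^\top\ \cdots\ y_{m,[k,k+d_m-1]}^\top]^\top$, and a feedback law $\mathbf{u}_k=\gamma(\mathbf{x}_k,\mathbf{v}_k)$, invertible with respect to $\mathbf{v}_k$, such that the system becomes $\Xi_{k+1}=\mathcal{A}\Xi_k+\mathcal{B}\mathbf{v}_k$, $\mathbf{y}_k=\mathcal{C}\Xi_k$, with $\mathcal{A},\mathcal{B},\mathcal{C}$ block diagonal with diagonal blocks $A_i\in\mathbb{R}^{d_i\times d_i}$ (ones on the first superdiagonal, zeros elsewhere), $B_i=[0\ \cdots\ 0\ 1]^\top\in\mathbb{R}^{d_i}$, $C_i=[1\ 0\ \cdots\ 0]\in\mathbb{R}^{1\times d_i}$. The synthetic input is $\mathbf{v}_k=\tilde\Phi(\mathbf{u}_k,\mathbf{x}_k)$, where the $i$-th component of $\tilde\Phi(\mathbf{u},\mathbf{x})$ is $h_i(\boldsymbol{f}_O^{d_i-1}(\boldsymbol{f}(\mathbf{x},\mathbf{u})))$.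 Define $\Phi(\mathbf{u},\Xi)=\tilde\Phi(\mathbf{u},T^{-1}(\Xi))$. Basis functions. $\Psi:\mathbb{R}^m\times\mathbb{R}^n\to\mathbb{R}^r$ is a vector of $r$ locally Lipschitz, linearly independent functions $\psi_1,\dots,\psi_r$. One writes $\Phi(\mathbf{u},\Xi)=\mathcal{G}\Psi(\mathbf{u},\Xi)+\epsilon(\mathbf{u},\Xi)$, where $\mathcal{G}\in\mathbb{R}^{m\times r}$ is a minimizer over $G$ of $\langle\Phi-G\Psi,\Phi-G\Psi\rangle$ ($L^2$ inner product over a compact set $\Omega\subset\mathbb{R}^m\times\mathbb{R}^n$) and $\epsilon$ is the approximation error. Assumption 4: $\mathcal{G}$ has full row rank. *)

theory Defs
  imports
    "Jordan_Normal_Form.DL_Rank"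
    "HOL-Analysis.Analysis"
begin

text \<open>
  Vectors of fixed dimension (states, inputs, outputs, basis function values) are of type
  \<^typ>\<open>real^'n\<close>; Hankel matrices and stacked windows, whose size depends on the numbers
  \<open>L\<close> and \<open>N\<close>, are carrier-based vectors and matrices. The symbols shared by both
  libraries are reserved for the former.
\<close>

no_notation Matrix.vec_index (infixl "$" 100)
no_notation Matrix.scalar_prod (infix "\<bullet>" 70)


section \<open>Analytic functions, partial derivatives, local Lipschitz continuity\<close>

text \<open>
  Local representation by a convergent power series around every point. A multi-index is a
  function \<open>\<mu>\<close> assigning an exponent to every basis vector; \<open>has_sum\<close> is unconditional
  summation over all multi-indices.
\<close>

definition real_analytic :: "('a::euclidean_space \<Rightarrow> 'b::euclidean_space) \<Rightarrow> bool" where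
  "real_analytic g \<longleftrightarrow>
    (\<forall>c. \<exists>a :: ('a \<Rightarrow> nat) \<Rightarrow> 'b. \<exists>e>0. \<forall>x\<in>ball c e.
      ((\<lambda>\<mu>. (\<Prod>b\<in>Basis. ((x - c) \<bullet> b) ^ \<mu> b) *\<^sub>R a \<mu>) has_sum g x) (Basis \<rightarrow>\<^sub>E UNIV))"

definition partial_deriv :: "(real^'m \<Rightarrow> real) \<Rightarrow> 'm \<Rightarrow> real^'m \<Rightarrow> real" where
  "partial_deriv g j u = deriv (\<lambda>t. g (u + t *\<^sub>R axis j 1)) 0"

definition locally_lipschitz :: "('a::metric_space \<Rightarrow> 'b::metric_space) \<Rightarrow> bool" where
  "locally_lipschitz g \<longleftrightarrow> (\<forall>z. \<exists>e>0. \<exists>C. C-lipschitz_on (ball z e) g)"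

definition components_linearly_independent :: "('a \<Rightarrow> real^'r) \<Rightarrow> bool" where
  "components_linearly_independent \<Psi> \<longleftrightarrow>
    (\<forall>c. (\<forall>z. (\<Sum>i\<in>UNIV. c i * \<Psi> z $ i) = 0) \<longrightarrow> (\<forall>i. c i = 0))"


section \<open>The system\<close>

primrec state :: "((real^'n) \<times> (real^'m) \<Rightarrow> real^'n) \<Rightarrow> real^'n \<Rightarrow> (nat \<Rightarrow> real^'m) \<Rightarrow> nat \<Rightarrow> real^'n"
  where
    "state f x u 0 = x"
  | "state f x u (Suc k) = f (state f x u k, u k)"

definition trajectory ::
  "((real^'n) \<times> (real^'m) \<Rightarrow> real^'n) \<Rightarrow> (real^'n \<Rightarrow> real^'m) \<Rightarrow> ('m \<Rightarrow> nat) \<Rightarrow> nat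
    \<Rightarrow> (nat \<Rightarrow> real^'m) \<Rightarrow> ('m \<Rightarrow> nat \<Rightarrow> real) \<Rightarrow> bool" where
  \<comment> \<open>Only \<open>u k\<close> for \<open>k < N\<close> and \<open>y i k\<close> for \<open>k < N + d i\<close> matter. The inputs from time \<open>N\<close>
    on are not part of the trajectory, hence the continuation \<open>w\<close>; by the meaning of the
    relative degrees, the listed outputs do not depend on it.\<close>
  "trajectory f h d N u y \<longleftrightarrow>
    (\<exists>x\<^sub>0 w. (\<forall>k<N. w k = u k) \<and> (\<forall>i. \<forall>k<N + d i. y i k = h (state f x\<^sub>0 w k) $ i))"

text \<open>
  \<open>\<delta>\<close> is the first delay at which the input at some time affects the \<open>i\<close>-th output, from every
  state.
\<close>

definition relative_degree ::
  "((real^'n) \<times> (real^'m) \<Rightarrow> real^'n) \<Rightarrow> (real^'n \<Rightarrow> real^'m) \<Rightarrow> 'm \<Rightarrow> nat \<Rightarrow> bool" where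
  "relative_degree f h i \<delta> \<longleftrightarrow>
    1 \<le> \<delta> \<and>
    (\<forall>x u u'. \<forall>j<\<delta>. h (state f x u j) $ i = h (state f x u' j) $ i) \<and>
    (\<forall>x. \<exists>u a. h (state f x (u(0 := a)) \<delta>) $ i \<noteq> h (state f x u \<delta>) $ i)"

definition Phi_tilde ::
  "((real^'n) \<times> (real^'m) \<Rightarrow> real^'n) \<Rightarrow> (real^'n \<Rightarrow> real^'m) \<Rightarrow> ('m \<Rightarrow> nat)
    \<Rightarrow> real^'m \<Rightarrow> real^'n \<Rightarrow> real^'m" where
  "Phi_tilde f h d u x = (\<chi> i. h (((\<lambda>z. f (z, 0)) ^^ (d i - 1)) (f (x, u))) $ i)"

definition decoupling_matrix ::
  "((real^'n) \<times> (real^'m) \<Rightarrow> real^'n) \<Rightarrow> (real^'n \<Rightarrow> real^'m) \<Rightarrow> ('m \<Rightarrow> nat)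
    \<Rightarrow> real^'n \<Rightarrow> real^'m \<Rightarrow> real^'m^'m" where
  "decoupling_matrix f h d x u = (\<chi> i j. partial_deriv (\<lambda>v. Phi_tilde f h d v x $ i) j u)"


section \<open>Transformed coordinates\<close>

text \<open>
  The entries of \<open>\<Xi>\<^sub>k\<close> are the numbers \<open>y\<^sub>i\<^sub>,\<^sub>k\<^sub>+\<^sub>j\<close> with \<open>j < d\<^sub>i\<close>. As the index type \<open>'n\<close> carries
  no order, the position of the entries is given by an enumeration \<open>pos\<close> of the pairs \<open>(i, j)\<close>.
\<close>

definition block_enumeration :: "('m \<Rightarrow> nat) \<Rightarrow> ('n \<Rightarrow> 'm \<times> nat) \<Rightarrow> bool" where
  "block_enumeration d pos \<longleftrightarrow> bij_betw pos UNIV (SIGMA i:UNIV. {..<d i})"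

definition Xi :: "('n \<Rightarrow> 'm \<times> nat) \<Rightarrow> ('m \<Rightarrow> nat \<Rightarrow> real) \<Rightarrow> nat \<Rightarrow> real^'n" where
  "Xi pos y k = (\<chi> p. y (fst (pos p)) (k + snd (pos p)))"

definition coordinate_transformation ::
  "((real^'n) \<times> (real^'m) \<Rightarrow> real^'n) \<Rightarrow> (real^'n \<Rightarrow> real^'m) \<Rightarrow> ('n \<Rightarrow> 'm \<times> nat)
    \<Rightarrow> (real^'n \<Rightarrow> real^'n) \<Rightarrow> bool" where
  "coordinate_transformation f h pos T \<longleftrightarrow>
    bij T \<and>
    (\<forall>x\<^sub>0 u k. Xi pos (\<lambda>i l. h (state f x\<^sub>0 u l) $ i) k = T (state f x\<^sub>0 u k))"

definition Phi ::
  "((real^'n) \<times> (real^'m) \<Rightarrow> real^'n) \<Rightarrow> (real^'n \<Rightarrow> real^'m) \<Rightarrow> ('m \<Rightarrow> nat)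
    \<Rightarrow> (real^'n \<Rightarrow> real^'n) \<Rightarrow> (real^'m) \<times> (real^'n) \<Rightarrow> real^'m" where
  "Phi f h d T = (\<lambda>(u, \<xi>). Phi_tilde f h d u (inv_into UNIV T \<xi>))"


section \<open>Basis function approximation\<close>

definition L2_inner ::
  "'a::euclidean_space set \<Rightarrow> ('a \<Rightarrow> 'b::euclidean_space) \<Rightarrow> ('a \<Rightarrow> 'b) \<Rightarrow> real" where
  "L2_inner \<Omega> p q = (LINT z:\<Omega>|lborel. p z \<bullet> q z)"

definition approx_error ::
  "('a \<Rightarrow> real^'m) \<Rightarrow> real^'r^'m \<Rightarrow> ('a \<Rightarrow> real^'r) \<Rightarrow> 'a \<Rightarrow> real^'m" where
  "approx_error \<phi> G \<Psi> = (\<lambda>z. \<phi> z - G *v \<Psi> z)"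

definition best_approximation ::
  "'a::euclidean_space set \<Rightarrow> ('a \<Rightarrow> real^'m) \<Rightarrow> ('a \<Rightarrow> real^'r) \<Rightarrow> real^'r^'m \<Rightarrow> bool" where
  "best_approximation \<Omega> \<phi> \<Psi> G \<longleftrightarrow>
    (\<forall>G'. L2_inner \<Omega> (approx_error \<phi> G \<Psi>) (approx_error \<phi> G \<Psi>)
        \<le> L2_inner \<Omega> (approx_error \<phi> G' \<Psi>) (approx_error \<phi> G' \<Psi>))"


section \<open>Hankel matrices and persistency of excitation\<close>

text \<open>
  \<^term>\<open>window z a l\<close> is the vector \<open>z\<^sub>[\<^sub>a\<^sub>,\<^sub>a\<^sub>+\<^sub>l\<^sub>-\<^sub>1\<^sub>]\<close>. Entry \<open>p\<close> belongs to the block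
  \<open>p div CARD('q)\<close>; within a block, the components are listed along the enumeration
  \<open>from_nat_into UNIV\<close> of the finite index type \<open>'q\<close>.
\<close>

definition window :: "(nat \<Rightarrow> real^'q) \<Rightarrow> nat \<Rightarrow> nat \<Rightarrow> real Matrix.vec" where
  "window z a l = Matrix.vec (CARD('q) * l)
    (\<lambda>p. z (a + p div CARD('q)) $ from_nat_into UNIV (p mod CARD('q)))"

text \<open>
  The Hankel matrix of depth \<open>L\<close> of the sequence \<open>z\<^sub>0, \<dots>, z\<^sub>M\<^sub>-\<^sub>1\<close>. The number of columns
  is written \<open>M + 1 - L\<close>, so that there are none if \<open>L > M\<close>.
\<close>

definition hankel :: "nat \<Rightarrow> nat \<Rightarrow> (nat \<Rightarrow> real^'q) \<Rightarrow> real Matrix.mat" where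
  "hankel L M z = mat_of_cols (CARD('q) * L) (map (\<lambda>j. window z j L) [0..<M + 1 - L])"

definition persistently_exciting :: "nat \<Rightarrow> nat \<Rightarrow> (nat \<Rightarrow> real^'q) \<Rightarrow> bool" where
  "persistently_exciting L M z \<longleftrightarrow>
    vec_space.rank (CARD('q) * L) (hankel L M z) = CARD('q) * L"

end

theory Submission
  imports Defs
begin

text \<open>
  In the coordinates \<open>\<Xi>\<close> the nonlinearity enters only through the basis functions: by the relative
  degrees and the nominal identity \<open>\<Phi> = G \<Psi>\<close>, a pair \<open>(u, y)\<close> is a trajectory exactly if
  \<open>y\<^sub>i\<^sub>,\<^sub>k\<^sub>+\<^sub>d\<^sub>i = (G \<psi>\<^sub>k)\<^sub>i\<close> for all \<open>k < L\<close>, where \<open>\<psi>\<^sub>k = \<Psi>(u\<^sub>k, \<Xi>\<^sub>k)\<close> (lemma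
  \<open>trajectory_iff_recursion\<close>). This relation is linear and time invariant in \<open>(\<psi>, y)\<close>, so a linear
  combination of shifted data satisfies it again, which gives one direction. Conversely, a solution
  is determined by \<open>\<psi>\<^sub>0, \<dots>, \<psi>\<^sub>L\<^sub>-\<^sub>1\<close> and \<open>\<Xi>\<^sub>0\<close> (lemma \<open>Xi_unique\<close>), so it suffices that the columns
  of the data matrix with row blocks \<open>H\<^sub>L(\<psi>)\<close> and \<open>H\<^sub>1(\<Xi>)\<close> span the whole space (lemma
  \<open>delay_chain_data_span\<close>).

  For general linear systems this rank condition is Willems' fundamental lemma, whose proof
  uses the theorem of Cayley and Hamilton. Here the state is made of pure delays, and its dynamics is
  nilpotent: after \<open>n\<close> steps every entry of \<open>\<Xi>\<^sub>j\<^sub>+\<^sub>n\<close> is the product of a row of \<open>G\<close> with one of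
  \<open>\<psi>\<^sub>j, \<dots>, \<psi>\<^sub>j\<^sub>+\<^sub>n\<^sub>-\<^sub>1\<close>. A left annihilator \<open>(\<eta>, \<xi>)\<close> of the data matrix therefore becomes an annihilator
  of the windows of \<open>\<psi>\<close> of length \<open>L + n\<close>. Persistency of excitation of that order makes it vanish,
  and then \<open>\<eta> = 0\<close> is immediate and \<open>\<xi> = 0\<close> follows from the full row rank of \<open>G\<close> (lemma
  \<open>delay_chain_annihilator_eq_0\<close>).
\<close>

section \<open>Full row rank\<close>

text \<open>
  The columns contain a basis of the whole space; collected in a square matrix, they make it
  invertible, and so is its transpose, whose kernel contains \<open>c\<close>.
\<close>

lemma full_row_rank_orthogonal_cols_eq_0:
  fixes A :: "'a::field mat"
  assumes A: "A \<in> carrier_mat n nc"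
    and rank: "vec_space.rank n A = n"
    and c: "c \<in> carrier_vec n"
    and orth: "\<forall>x\<in>set (cols A). scalar_prod c x = 0"
  shows "c = 0\<^sub>v n"
proof -
  interpret vec_space "TYPE('a)" n .
  obtain U where U: "finite U" "maximal U (\<lambda>S. S \<subseteq> set (cols A) \<and> lin_indpt S)"
    using maximal_exists_superset[of "set (cols A)" "\<lambda>S. S \<subseteq> set (cols A) \<and> lin_indpt S" "{}"]
    by (auto simp: finite_lin_indpt2)
  have card_U: "card U = n"
    using rank_card_indpt[OF A U(2)] rank by simp
  have U_cols: "U \<subseteq> set (cols A)" and U_indpt: "lin_indpt U"
    using U(2) by (auto simp: maximal_def)
  obtain us where us: "set us = U" "distinct us"
    using U(1) finite_distinct_list by blast
  have len: "length us = n" using us card_U distinct_card by fastforce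
  have us_carrier: "set us \<subseteq> carrier_vec n"
    using U_cols us(1) cols_dim[of A] A by auto
  define B where "B = mat_of_cols n us"
  have B: "B \<in> carrier_mat n n" and cols_B: "cols B = us"
    using us_carrier len by (auto simp: B_def)
  have "rank B = n"
    using lin_indpt_full_rank[OF B] cols_B us U_indpt by simp
  then have "Determinant.det (transpose_mat B) \<noteq> 0"
    using det_rank_iff[OF B] Determinant.det_transpose[OF B] by simp
  moreover have "transpose_mat B *\<^sub>v c = 0\<^sub>v n"
  proof (rule eq_vecI)
    fix j assume "j < dim_vec (0\<^sub>v n)"
    then have j: "j < n" by simp
    have colj: "col B j \<in> set (cols A)"
      using j B cols_B U_cols us(1) len by (metis carrier_matD(2) cols_nth nth_mem subsetD)
    have "scalar_prod (col B j) c = scalar_prod c (col B j)"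
      using c B j by (intro comm_scalar_prod[of _ n]) auto
    then show "vec_index (transpose_mat B *\<^sub>v c) j = vec_index (0\<^sub>v n) j"
      using j B orth colj by simp
  qed (use B in auto)
  ultimately show ?thesis
    using det_0_iff_vec_prod_zero[of "transpose_mat B" n] B c by auto
qed

text \<open>
  The Gram matrix \<open>A A\<^sup>T\<close> is invertible: \<open>A A\<^sup>T c = 0\<close> implies that \<open>A\<^sup>T c\<close> has norm zero, so that
  \<open>c\<close> annihilates the range of \<open>A\<close>. Then \<open>A\<^sup>T (A A\<^sup>T)\<^sup>-\<^sup>1 b\<close> is a solution.
\<close>

lemma trivial_left_kernel_imp_solvable:
  fixes A :: "real mat"
  assumes A: "A \<in> carrier_mat nr nc"
    and ker: "\<And>c. \<lbrakk>c \<in> carrier_vec nr; \<forall>v\<in>carrier_vec nc. scalar_prod c (A *\<^sub>v v) = 0\<rbrakk> \<Longrightarrow> c = 0\<^sub>v nr"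
    and b: "b \<in> carrier_vec nr"
  shows "\<exists>\<alpha>\<in>carrier_vec nc. A *\<^sub>v \<alpha> = b"
proof -
  define S where "S = A * transpose_mat A"
  have S: "S \<in> carrier_mat nr nr" using A by (simp add: S_def)
  have "Determinant.det S \<noteq> 0"
  proof
    assume "Determinant.det S = 0"
    then obtain c where c: "c \<in> carrier_vec nr" "c \<noteq> 0\<^sub>v nr" "S *\<^sub>v c = 0\<^sub>v nr"
      using det_0_iff_vec_prod_zero[OF S] by blast
    define w where "w = transpose_mat A *\<^sub>v c"
    have w: "w \<in> carrier_vec nc" using A c(1) by (simp add: w_def)
    have "A *\<^sub>v w = 0\<^sub>v nr"
      using c A by (simp add: w_def S_def assoc_mult_mat_vec[of _ nr nc _ nr])
    then have "scalar_prod w w = 0"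
      using transpose_vec_mult_scalar[OF A w c(1)] c(1) by (simp add: w_def)
    then have w0: "w = 0\<^sub>v nc"
      using conjugate_square_eq_0_vec[OF w] by simp
    have "scalar_prod c (A *\<^sub>v v) = 0" if "v \<in> carrier_vec nc" for v
      using transpose_vec_mult_scalar[OF A that c(1)] that w0 by (simp add: w_def)
    with ker c show False by blast
  qed
  then obtain R where R: "R \<in> carrier_mat nr nr" "S * R = 1\<^sub>m nr"
    using det_non_zero_imp_unit[OF S] by (auto simp: Units_def ring_mat_def)
  have "A *\<^sub>v (transpose_mat A *\<^sub>v (R *\<^sub>v b)) = S *\<^sub>v (R *\<^sub>v b)"
    using A R(1) b by (simp add: S_def assoc_mult_mat_vec[of _ nr nc _ nr])
  also have "\<dots> = b"
    using S R b by (simp add: assoc_mult_mat_vec[of _ nr nr _ nr, symmetric])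
  finally show ?thesis
    using A R b by (intro bexI[of _ "transpose_mat A *\<^sub>v (R *\<^sub>v b)"]) auto
qed

text \<open>
  As \<open>G\<close> is surjective, some \<open>x\<close> has inner product \<open>1\<close> with the row \<open>\<iota> p\<close> and \<open>0\<close> with all
  others; pairing the vanishing combination with \<open>x\<close> isolates the coefficient of \<open>p\<close>.
\<close>

lemma full_row_rank_independent_rows:
  fixes G :: "real^'r^'m"
  assumes rank: "rank G = CARD('m)"
    and inj: "inj_on \<iota> S"
    and fin: "finite S"
    and sum0: "(\<Sum>p\<in>S. \<xi> p *\<^sub>R G $ \<iota> p) = 0"
    and p: "p \<in> S"
  shows "\<xi> p = 0"
proof -
  obtain x where x: "G *v x = axis (\<iota> p) 1"
    using rank by (metis full_rank_surjective surjD)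
  have row: "G $ i \<bullet> x = (if i = \<iota> p then 1 else 0)" for i
  proof -
    have "(G *v x) $ i = G $ i \<bullet> x" by (rule matrix_vector_mul_component)
    then show ?thesis by (auto simp: x axis_def)
  qed
  have "0 = (\<Sum>q\<in>S. \<xi> q *\<^sub>R G $ \<iota> q) \<bullet> x" by (simp add: sum0)
  also have "\<dots> = (\<Sum>q\<in>S. \<xi> q * (if \<iota> q = \<iota> p then 1 else 0))"
    by (simp add: inner_sum_left row)
  also have "\<dots> = (\<Sum>q\<in>S. if q = p then \<xi> q else 0)"
    using inj p by (intro sum.cong) (auto simp: inj_on_def)
  also have "\<dots> = \<xi> p" using p fin by simp
  finally show ?thesis by simp
qed

section \<open>Windows and Hankel matrices\<close>

lemma window_carrier [simp]:
  fixes z :: "nat \<Rightarrow> real^'q"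
  shows "window z a l \<in> carrier_vec (CARD('q) * l)"
  by (simp add: window_def)

lemma bij_betw_component_enumeration:
  "bij_betw (from_nat_into (UNIV :: 'q::finite set)) {..<CARD('q)} UNIV"
  by (rule bij_betw_from_nat_into_finite) simp

lemma window_cong:
  assumes "\<And>k. k < l \<Longrightarrow> z (a + k) = z' (b + k)"
  shows "window z a l = window z' b l"
proof (rule eq_vecI)
  fix p assume "p < dim_vec (window z' b l)"
  then show "vec_index (window z a l) p = vec_index (window z' b l) p"
    using assms[of "p div CARD('a)"] 
    by (simp add: window_def less_mult_imp_div_less mult.commute)
qed (simp add: window_def)

text \<open>
  By this formula orthogonality to the columns of a Hankel matrix becomes a family of equations
  between the members of the sequences, and the enumeration of the components disappears.
\<close>

lemma scalar_prod_window:
  fixes z z' :: "nat \<Rightarrow> real^'q"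
  shows "scalar_prod (window z a l) (window z' b l) = (\<Sum>k<l. z (a + k) \<bullet> z' (b + k))"
proof -
  let ?q = "CARD('q)" and ?e = "from_nat_into (UNIV :: 'q set)"
  let ?g = "\<lambda>p. z (a + p div ?q) $ ?e (p mod ?q) * z' (b + p div ?q) $ ?e (p mod ?q)"
  have "scalar_prod (window z a l) (window z' b l) = sum ?g {..<l * ?q}"
    by (auto simp: scalar_prod_def window_def atLeast0LessThan mult.commute intro!: sum.cong)
  also have "\<dots> = (\<Sum>k<l. sum ?g {k * ?q..<k * ?q + ?q})"
    by (rule sum.nat_group[symmetric])
  also have "\<dots> = (\<Sum>k<l. z (a + k) \<bullet> z' (b + k))"
  proof (rule sum.cong[OF refl])
    fix k
    have "sum ?g {k * ?q..<k * ?q + ?q} = (\<Sum>s<?q. ?g (s + k * ?q))"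
      using sum.shift_bounds_nat_ivl[of ?g 0 "k * ?q" ?q]
      by (simp add: atLeast0LessThan add.commute)
    also have "\<dots> = (\<Sum>s<?q. z (a + k) $ ?e s * z' (b + k) $ ?e s)"
      by (intro sum.cong) auto
    also have "\<dots> = (\<Sum>i\<in>UNIV. z (a + k) $ i * z' (b + k) $ i)"
      by (rule sum.reindex_bij_betw[OF bij_betw_component_enumeration])
    finally show "sum ?g {k * ?q..<k * ?q + ?q} = z (a + k) \<bullet> z' (b + k)"
      by (simp add: inner_vec_def)
  qed
  finally show ?thesis .
qed

lemma window_eq_iff:
  fixes z z' :: "nat \<Rightarrow> real^'q"
  shows "window z 0 l = window z' 0 l \<longleftrightarrow> (\<forall>k<l. z k = z' k)"
proof
  assume eq: "window z 0 l = window z' 0 l"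
  let ?w = "window (\<lambda>k. z k - z' k) 0 l"
  have "scalar_prod ?w (window z 0 l) = scalar_prod ?w (window z' 0 l)"
    by (simp add: eq)
  then have "(\<Sum>k<l. (z k - z' k) \<bullet> (z k - z' k)) = 0"
    by (simp add: scalar_prod_window inner_diff_right sum_subtractf)
  then show "\<forall>k<l. z k = z' k"
    by (simp add: sum_nonneg_eq_0_iff)
qed (simp add: window_cong)

lemma carrier_vec_eq_window:
  assumes v: "v \<in> carrier_vec (CARD('q) * l)"
  obtains z :: "nat \<Rightarrow> real^'q" where "v = window z 0 l"
proof
  let ?q = "CARD('q)" and ?e = "from_nat_into (UNIV :: 'q set)"
  let ?z = "\<lambda>k. \<chi> i. vec_index v (k * ?q + the_inv_into {..<?q} ?e i)"
  show "v = window ?z 0 l"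
  proof (rule eq_vecI)
    fix p
    have "the_inv_into {..<?q} ?e (?e (p mod ?q)) = p mod ?q"
      using bij_betw_component_enumeration[where 'q='q]
      by (intro the_inv_into_f_f) (auto simp: bij_betw_def)
    moreover assume "p < dim_vec (window ?z 0 l)"
    ultimately show "vec_index v p = vec_index (window ?z 0 l) p"
      by (simp add: window_def)
  qed (use v in \<open>simp add: window_def\<close>)
qed

lemma hankel_carrier [simp]:
  fixes z :: "nat \<Rightarrow> real^'q"
  shows "hankel l M z \<in> carrier_mat (CARD('q) * l) (M + 1 - l)"
  using mat_of_cols_carrier(1)[of "CARD('q) * l" "map (\<lambda>j. window z j l) [0..<M + 1 - l]"]
  by (simp add: hankel_def)

lemma set_cols_hankel: "set (cols (hankel l M z)) = (\<lambda>j. window z j l) ` {..<M + 1 - l}"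
proof -
  have "set (map (\<lambda>j. window z j l) [0..<M + 1 - l]) \<subseteq> carrier_vec (CARD('a) * l)"
    by auto
  then show ?thesis
    unfolding hankel_def by (subst cols_mat_of_cols) auto
qed

lemma hankel_mult_vec:
  fixes z :: "nat \<Rightarrow> real^'q"
  assumes \<alpha>: "\<alpha> \<in> carrier_vec (M + 1 - l)"
  shows "hankel l M z *\<^sub>v \<alpha> = window (\<lambda>k. \<Sum>j<M + 1 - l. vec_index \<alpha> j *\<^sub>R z (j + k)) 0 l"
proof (rule eq_vecI)
  fix p assume "p < dim_vec (window (\<lambda>k. \<Sum>j<M + 1 - l. vec_index \<alpha> j *\<^sub>R z (j + k)) 0 l)"
  then have p: "p < CARD('q) * l" by (simp add: window_def)
  have "vec_index (hankel l M z *\<^sub>v \<alpha>) p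
      = (\<Sum>j<M + 1 - l. (hankel l M z $$ (p, j)) * vec_index \<alpha> j)"
    using p \<alpha> hankel_carrier[of l M z]
    by (auto simp: scalar_prod_def atLeast0LessThan intro!: sum.cong)
  also have "\<dots> = (\<Sum>j<M + 1 - l. vec_index \<alpha> j
      * z (j + p div CARD('q)) $ from_nat_into UNIV (p mod CARD('q)))"
    using p by (intro sum.cong) (auto simp: hankel_def mat_of_cols_index window_def)
  finally show "vec_index (hankel l M z *\<^sub>v \<alpha>) p
      = vec_index (window (\<lambda>k. \<Sum>j<M + 1 - l. vec_index \<alpha> j *\<^sub>R z (j + k)) 0 l) p"
    using p by (simp add: window_def)
qed (use hankel_carrier[of l M z] in \<open>simp add: window_def\<close>)

lemma stacked_hankel_mult_vec:
  fixes z :: "nat \<Rightarrow> real^'q" and z' :: "nat \<Rightarrow> real^'s"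
  assumes cols: "M' + 1 - l' = M + 1 - l"
    and \<alpha>: "\<alpha> \<in> carrier_vec (M + 1 - l)"
  shows "(hankel l M z @\<^sub>r hankel l' M' z') *\<^sub>v \<alpha>
    = window (\<lambda>k. \<Sum>j<M + 1 - l. vec_index \<alpha> j *\<^sub>R z (j + k)) 0 l
      @\<^sub>v window (\<lambda>k. \<Sum>j<M + 1 - l. vec_index \<alpha> j *\<^sub>R z' (j + k)) 0 l'"
proof -
  have "hankel l' M' z' \<in> carrier_mat (CARD('s) * l') (M + 1 - l)"
    using hankel_carrier[of l' M' z'] by (simp only: cols)
  moreover have "hankel l' M' z' *\<^sub>v \<alpha>
      = window (\<lambda>k. \<Sum>j<M + 1 - l. vec_index \<alpha> j *\<^sub>R z' (j + k)) 0 l'"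
    using hankel_mult_vec[of \<alpha> M' l' z'] \<alpha> by (simp only: cols)
  ultimately show ?thesis
    by (simp only: mat_mult_append[OF hankel_carrier _ \<alpha>] hankel_mult_vec[OF \<alpha>])
qed

lemma persistently_exciting_annihilator:
  fixes z :: "nat \<Rightarrow> real^'q"
  assumes pe: "persistently_exciting K M z"
    and ann: "\<And>j. j < M + 1 - K \<Longrightarrow> (\<Sum>k<K. c k \<bullet> z (j + k)) = 0"
  shows "\<forall>k<K. c k = 0"
proof -
  have "window c 0 K = 0\<^sub>v (CARD('q) * K)"
  proof (rule full_row_rank_orthogonal_cols_eq_0[OF hankel_carrier])
    show "\<forall>x\<in>set (cols (hankel K M z)). scalar_prod (window c 0 K) x = 0"
      using ann by (auto simp: set_cols_hankel scalar_prod_window)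
  qed (use pe in \<open>auto simp: persistently_exciting_def\<close>)
  also have "\<dots> = window (\<lambda>_. 0 :: real^'q) 0 K"
    by (rule eq_vecI) (auto simp: window_def)
  finally show ?thesis by (simp add: window_eq_iff)
qed

section \<open>Input-output form of the system\<close>

lemma state_add: "state f x u (k + l) = state f (state f x u k) (\<lambda>j. u (k + j)) l"
  by (induction l) auto

lemma state_zero_input: "state f x (\<lambda>_. 0) k = ((\<lambda>z. f (z, 0)) ^^ k) x"
  by (induction k) auto

text \<open>
  Starting from the state at time \<open>k + 1\<close>, the output \<open>d i - 1\<close> steps later depends on no further
  inputs, so these may be replaced by the zero inputs that occur in \<^const>\<open>Phi_tilde\<close>.
\<close>

lemma output_at_relative_degree:
  assumes "relative_degree f h i (d i)"
  shows "h (state f x u (k + d i)) $ i = Phi_tilde f h d (u k) (state f x u k) $ i"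
proof -
  have pos: "1 \<le> d i" and indep: "\<And>x u u' j. j < d i \<Longrightarrow> h (state f x u j) $ i = h (state f x u' j) $ i"
    using assms unfolding relative_degree_def by blast+
  let ?x1 = "f (state f x u k, u k)"
  have "state f x u (k + d i) = state f ?x1 (\<lambda>j. u (Suc k + j)) (d i - 1)"
    using state_add[of f x u "Suc k" "d i - 1"] pos by simp
  then have "h (state f x u (k + d i)) $ i = h (state f ?x1 (\<lambda>_. 0) (d i - 1)) $ i"
    using indep[of "d i - 1"] pos by auto
  then show ?thesis
    by (simp add: state_zero_input Phi_tilde_def)
qed

lemma block_position:
  assumes "block_enumeration d pos" "l < d i"
  obtains p where "pos p = (i, l)"
  using assms unfolding block_enumeration_def bij_betw_def
  by (metis (no_types, lifting) UNIV_I SigmaI image_iff lessThan_iff)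

lemma snd_block_position_less:
  assumes "block_enumeration d pos"
  shows "snd (pos p) < d (fst (pos p))"
proof -
  have "pos p \<in> (SIGMA i:UNIV. {..<d i})"
    using assms unfolding block_enumeration_def by (meson UNIV_I bij_betwE)
  then show ?thesis by (auto simp: mem_Sigma_iff split_beta)
qed

lemma Xi_eqD:
  assumes "block_enumeration d pos" "Xi pos y k = Xi pos y' k" "l < d i"
  shows "y i (k + l) = y' i (k + l)"
proof -
  obtain p where p: "pos p = (i, l)"
    using block_position[OF assms(1,3)] .
  have "Xi pos y k $ p = Xi pos y' k $ p" using assms(2) by simp
  then show ?thesis by (simp add: Xi_def p)
qed

text \<open>
  From one time to the next, every block of \<^const>\<open>Xi\<close> is shifted and only its last entry is new.
  Hence two output sequences with the same initial \<open>\<Xi>\<close> agree as long as agreement up to time \<open>k\<close>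
  forces the new entries \<open>y i (k + d i)\<close> to agree. The comparison is made once with outputs
  simulated by the system, and once with a superposition of data.
\<close>

lemma Xi_unique:
  assumes blocks: "block_enumeration d pos"
    and init: "Xi pos y 0 = Xi pos y' 0"
    and step: "\<And>k i. \<lbrakk>k < L; Xi pos y k = Xi pos y' k\<rbrakk> \<Longrightarrow> y i (k + d i) = y' i (k + d i)"
    and "k \<le> L"
  shows "Xi pos y k = Xi pos y' k"
  using \<open>k \<le> L\<close>
proof (induction k)
  case 0
  show ?case by (rule init)
next
  case (Suc k)
  then have IH: "Xi pos y k = Xi pos y' k" and k: "k < L" by auto
  have "y i (Suc k + l) = y' i (Suc k + l)" if l: "l < d i" for i l
  proof (cases "Suc l < d i")
    case True
    then show ?thesis using Xi_eqD[OF blocks IH True] by simp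
  next
    case False
    then have "Suc k + l = k + d i" using l by simp
    then show ?thesis using step[OF k IH] by metis
  qed
  then show ?case
    using snd_block_position_less[OF blocks] by (auto simp: Xi_def vec_eq_iff)
qed

text \<open>
  The recursion holds along every run of the system, as \<open>\<Xi>\<close> is the image of the state under \<open>T\<close>.
  Conversely, outputs that satisfy it coincide with those of the run started at \<open>T\<^sup>-\<^sup>1(\<Xi>\<^sub>0)\<close>, because
  the recursion determines them from \<open>\<Xi>\<^sub>0\<close> and the inputs.
\<close>

lemma trajectory_iff_recursion:
  assumes rel_degree: "\<forall>i. relative_degree f h i (d i)"
    and blocks: "block_enumeration d pos"
    and T: "coordinate_transformation f h pos T"
    and nominal: "\<forall>z. approx_error (Phi f h d T) G \<Psi> z = 0"
  shows "trajectory f h d L u y \<longleftrightarrow>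
    (\<forall>k<L. \<forall>i. y i (k + d i) = (G *v \<Psi> (u k, Xi pos y k)) $ i)"
proof -
  let ?out = "\<lambda>x w i l. h (state f x w l) $ i"
  have bij: "bij T" and Xi_out: "\<And>x w k. Xi pos (?out x w) k = T (state f x w k)"
    using T unfolding coordinate_transformation_def by blast+
  have out: "?out x w i (k + d i) = (G *v \<Psi> (w k, Xi pos (?out x w) k)) $ i" for x w i k
  proof -
    have "?out x w i (k + d i) = Phi f h d T (w k, T (state f x w k)) $ i"
      using output_at_relative_degree[of f h i d x w k] rel_degree inv_into_f_f[OF bij_is_inj[OF bij]]
      by (simp add: Phi_def)
    also have "\<dots> = (G *v \<Psi> (w k, T (state f x w k))) $ i"
      using nominal by (simp add: approx_error_def)
    finally show ?thesis by (simp add: Xi_out)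
  qed
  show ?thesis
  proof
    assume "trajectory f h d L u y"
    then obtain x w where w: "\<forall>k<L. w k = u k" and y: "\<And>i k. k < L + d i \<Longrightarrow> y i k = ?out x w i k"
      unfolding trajectory_def by blast
    show "\<forall>k<L. \<forall>i. y i (k + d i) = (G *v \<Psi> (u k, Xi pos y k)) $ i"
    proof (intro allI impI)
      fix k i assume k: "k < L"
      have "Xi pos y k = Xi pos (?out x w) k"
        using y[OF add_strict_mono[OF k snd_block_position_less[OF blocks]]]
        by (simp add: Xi_def vec_eq_iff)
      then show "y i (k + d i) = (G *v \<Psi> (u k, Xi pos y k)) $ i"
        using y[where k = "k + d i" and i = i] out[where x = x and w = w and k = k and i = i] w k by simp
    qed
  next
    assume rec: "\<forall>k<L. \<forall>i. y i (k + d i) = (G *v \<Psi> (u k, Xi pos y k)) $ i"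
    define x where "x = inv_into UNIV T (Xi pos y 0)"
    have init: "Xi pos y 0 = Xi pos (?out x u) 0"
      using surj_f_inv_f[OF bij_is_surj[OF bij], of "Xi pos y 0"] by (simp add: Xi_out x_def)
    have eq: "Xi pos y k = Xi pos (?out x u) k" if "k \<le> L" for k
      using blocks init _ that
    proof (rule Xi_unique)
      show "y i (k + d i) = ?out x u i (k + d i)"
        if "k < L" "Xi pos y k = Xi pos (?out x u) k" for k i
        using that rec out[where x = x and w = u and k = k and i = i] by metis
    qed
    \<comment> \<open>Outputs before time \<open>L\<close> are first entries of blocks; the rest fills the blocks at time \<open>L\<close>.\<close>
    have "y i k = ?out x u i k" if k: "k < L + d i" for i k
    proof (cases "k < L")
      case True
      have "0 < d i" using rel_degree by (auto simp: relative_degree_def Suc_le_eq)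
      then show ?thesis using Xi_eqD[OF blocks eq, where k = k and l = 0 and i = i] True by simp
    next
      case False
      then show ?thesis using Xi_eqD[OF blocks eq, where k = L and l = "k - L" and i = i] k by simp
    qed
    then show "trajectory f h d L u y"
      unfolding trajectory_def by (intro exI[of _ x] exI[of _ u]) auto
  qed
qed

section \<open>The fundamental lemma for chains of delays\<close>

lemma sum_lessThan_add:
  fixes g :: "nat \<Rightarrow> 'a::comm_monoid_add"
  shows "(\<Sum>s<a + b. g s) = (\<Sum>s<a. g s) + (\<Sum>k<b. g (a + k))"
  by (induction b) (simp_all add: add.assoc)

text \<open>
  The annihilation condition is used only for the columns \<open>j + n\<close>, where the state has forgotten its
  initial value. There, entry \<open>p\<close> with \<open>pos p = (i, l)\<close> equals \<open>G\<^sub>i \<bullet> \<psi>\<^sub>j\<^sub>+\<^sub>s\<close> with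
  \<open>s = n + l - d\<^sub>i < n\<close>, so the \<open>\<xi>\<close> part occupies the first \<open>n\<close> places of a window of length
  \<open>L + n\<close>, and the \<open>\<eta>\<close> part the last \<open>L\<close> places. As \<open>(i, s)\<close> determines \<open>l\<close>, the entries that share
  a place \<open>s\<close> belong to distinct rows of \<open>G\<close>, and their coefficients vanish one by one.
\<close>

lemma delay_chain_annihilator_eq_0:
  fixes pos :: "'n::finite \<Rightarrow> 'm::finite \<times> nat" and G :: "real^'r^'m" and \<psi> \<eta> :: "nat \<Rightarrow> real^'r"
    and \<xi> :: "real^'n"
  assumes blocks: "block_enumeration d pos"
    and total: "(\<Sum>i\<in>UNIV. d i) = CARD('n)"
    and G: "rank G = CARD('m)"
    and chain: "\<forall>k<N. \<forall>i. y i (k + d i) = (G *v \<psi> k) $ i"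
    and pe: "persistently_exciting (L + CARD('n)) N \<psi>"
    and ann: "\<And>j. j < N + 1 - L \<Longrightarrow> (\<Sum>k<L. \<eta> k \<bullet> \<psi> (j + k)) + \<xi> \<bullet> Xi pos y j = 0"
  shows "\<forall>k<L. \<eta> k = 0" and "\<xi> = 0"
proof -
  let ?n = "CARD('n)"
  let ?i = "\<lambda>p. fst (pos p)"
  define slot where "slot p = ?n + snd (pos p) - d (?i p)" for p
  have d_le: "d i \<le> ?n" for i
    using member_le_sum[of i UNIV d] total by simp
  have snd_less: "snd (pos p) < d (?i p)" for p
    by (rule snd_block_position_less[OF blocks])
  have slot_less: "slot p < ?n" for p
    using snd_less[of p] d_le[of "?i p"] by (simp add: slot_def)
  define \<rho> where "\<rho> s = (\<Sum>p | slot p = s. \<xi> $ p *\<^sub>R G $ ?i p)" for s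
  define c where "c s = (if s < ?n then \<rho> s else \<eta> (s - ?n))" for s
  have "\<forall>s<L + ?n. c s = 0"
    using pe
  proof (rule persistently_exciting_annihilator)
    fix j assume "j < N + 1 - (L + ?n)"
    then have j: "j + ?n < N + 1 - L" by simp
    have entry: "Xi pos y (j + ?n) $ p = G $ ?i p \<bullet> \<psi> (j + slot p)" for p
    proof -
      have "j + ?n + snd (pos p) = (j + slot p) + d (?i p)"
        using d_le[of "?i p"] by (simp add: slot_def)
      moreover have "j + slot p < N" using slot_less[of p] j by simp
      ultimately have "y (?i p) (j + ?n + snd (pos p)) = (G *v \<psi> (j + slot p)) $ ?i p"
        using chain by metis
      then show ?thesis by (simp add: Xi_def matrix_vector_mul_component)
    qed
    have "\<xi> \<bullet> Xi pos y (j + ?n) = (\<Sum>p\<in>UNIV. \<xi> $ p * (G $ ?i p \<bullet> \<psi> (j + slot p)))"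
      by (simp add: inner_vec_def[of \<xi>] entry)
    also have "\<dots> = (\<Sum>s<?n. \<Sum>p | p \<in> UNIV \<and> slot p = s. \<xi> $ p * (G $ ?i p \<bullet> \<psi> (j + slot p)))"
      using slot_less by (intro sum.group[symmetric]) auto
    also have "\<dots> = (\<Sum>s<?n. \<rho> s \<bullet> \<psi> (j + s))"
      by (simp add: \<rho>_def inner_sum_left)
    finally have xi: "\<xi> \<bullet> Xi pos y (j + ?n) = (\<Sum>s<?n. \<rho> s \<bullet> \<psi> (j + s))" .
    have "(\<Sum>s<L + ?n. c s \<bullet> \<psi> (j + s))
        = (\<Sum>s<?n. c s \<bullet> \<psi> (j + s)) + (\<Sum>k<L. c (?n + k) \<bullet> \<psi> (j + (?n + k)))"
      by (simp only: add.commute[of L] sum_lessThan_add)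
    also have "\<dots> = 0"
      using ann[OF j] by (simp add: c_def xi add_ac)
    finally show "(\<Sum>s<L + ?n. c s \<bullet> \<psi> (j + s)) = 0" .
  qed
  then have c0: "c s = 0" if "s < L + ?n" for s using that by blast
  show "\<forall>k<L. \<eta> k = 0"
  proof (intro allI impI)
    fix k assume "k < L"
    then show "\<eta> k = 0" using c0[of "?n + k"] by (simp add: c_def)
  qed
  show "\<xi> = 0"
  proof -
    have "\<xi> $ p = 0" for p
    proof (rule full_row_rank_independent_rows[OF G,
          where \<xi> = "vec_nth \<xi>" and \<iota> = ?i and S = "{q. slot q = slot p}"])
      show "(\<Sum>q | slot q = slot p. \<xi> $ q *\<^sub>R G $ ?i q) = 0"
        using c0[of "slot p"] slot_less[of p] by (simp add: c_def \<rho>_def)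
      show "inj_on ?i {q. slot q = slot p}"
      proof (rule inj_onI)
        fix q q' assume q: "q \<in> {q. slot q = slot p}" "q' \<in> {q. slot q = slot p}" "?i q = ?i q'"
        then have "snd (pos q) = snd (pos q')"
          using d_le[of "?i q"] by (simp add: slot_def)
        then have "pos q = pos q'" using q(3) by (simp add: prod_eq_iff)
        then show "q = q'"
          using blocks by (auto simp: block_enumeration_def bij_betw_def dest: injD)
      qed
    qed auto
    then show ?thesis by (simp add: vec_eq_iff)
  qed
qed

text \<open>
  This is full row rank of the matrix with row blocks \<open>H\<^sub>L(\<psi>)\<close> and \<open>H\<^sub>1(\<Xi>)\<close>, stated as
  solvability: its left annihilators are those excluded above. A single block row of \<open>\<Xi>\<close> is
  enough, since the later values are determined by \<open>\<psi>'\<close> and the initial one.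
\<close>

lemma delay_chain_data_span:
  fixes pos :: "'n::finite \<Rightarrow> 'm::finite \<times> nat" and G :: "real^'r^'m" and \<psi> \<psi>' :: "nat \<Rightarrow> real^'r"
    and \<xi>' :: "real^'n"
  assumes blocks: "block_enumeration d pos"
    and total: "(\<Sum>i\<in>UNIV. d i) = CARD('n)"
    and G: "rank G = CARD('m)"
    and chain: "\<forall>k<N. \<forall>i. y i (k + d i) = (G *v \<psi> k) $ i"
    and pe: "persistently_exciting (L + CARD('n)) N \<psi>"
  shows "\<exists>\<alpha>\<in>carrier_vec (N + 1 - L).
    (\<forall>k<L. \<psi>' k = (\<Sum>j<N + 1 - L. vec_index \<alpha> j *\<^sub>R \<psi> (j + k))) \<and>
    \<xi>' = (\<Sum>j<N + 1 - L. vec_index \<alpha> j *\<^sub>R Xi pos y j)"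
proof -
  let ?nc = "N + 1 - L"
  let ?U = "hankel L N \<psi>" and ?X = "hankel 1 (N + 1 - L) (Xi pos y)"
  let ?nr = "CARD('r) * L + CARD('n) * 1"
  have U: "?U \<in> carrier_mat (CARD('r) * L) ?nc" and X: "?X \<in> carrier_mat (CARD('n) * 1) ?nc"
    using hankel_carrier[of L N \<psi>] hankel_carrier[of 1 "N + 1 - L" "Xi pos y"] by simp_all
  have mult: "(?U @\<^sub>r ?X) *\<^sub>v v
      = window (\<lambda>k. \<Sum>j<?nc. vec_index v j *\<^sub>R \<psi> (j + k)) 0 L
        @\<^sub>v window (\<lambda>k. \<Sum>j<?nc. vec_index v j *\<^sub>R Xi pos y (j + k)) 0 1"
    if "v \<in> carrier_vec ?nc" for v
    by (rule stacked_hankel_mult_vec) (use that in simp_all)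
  have "\<exists>\<alpha>\<in>carrier_vec ?nc. (?U @\<^sub>r ?X) *\<^sub>v \<alpha> = window \<psi>' 0 L @\<^sub>v window (\<lambda>_. \<xi>') 0 1"
  proof (rule trivial_left_kernel_imp_solvable)
    show "?U @\<^sub>r ?X \<in> carrier_mat ?nr ?nc" using U X by simp
    show "window \<psi>' 0 L @\<^sub>v window (\<lambda>_. \<xi>') 0 1 \<in> carrier_vec ?nr"
      using window_carrier[of \<psi>' 0 L] window_carrier[of "\<lambda>_. \<xi>'" 0 1]
      by (intro append_carrier_vec) auto
  next
    fix c :: "real Matrix.vec"
    assume c: "c \<in> carrier_vec ?nr"
      and orth: "\<forall>v\<in>carrier_vec ?nc. scalar_prod c ((?U @\<^sub>r ?X) *\<^sub>v v) = 0"
    obtain \<eta> :: "nat \<Rightarrow> real^'r" where \<eta>: "vec_first c (CARD('r) * L) = window \<eta> 0 L"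
      using carrier_vec_eq_window[where 'q='r, OF vec_first_carrier] by blast
    obtain \<zeta> :: "nat \<Rightarrow> real^'n" where \<zeta>: "vec_last c (CARD('n) * 1) = window \<zeta> 0 1"
      using carrier_vec_eq_window[where 'q='n, OF vec_last_carrier] by blast
    have c_eq: "c = window \<eta> 0 L @\<^sub>v window \<zeta> 0 1"
      using vec_first_last_append[OF c] \<eta> \<zeta> by simp
    have prod: "scalar_prod c (window a 0 L @\<^sub>v window b 0 1) = (\<Sum>k<L. \<eta> k \<bullet> a k) + \<zeta> 0 \<bullet> b 0"
      for a :: "nat \<Rightarrow> real^'r" and b :: "nat \<Rightarrow> real^'n"
      unfolding c_eq
      by (subst scalar_prod_append[OF window_carrier window_carrier window_carrier window_carrier])
        (simp add: scalar_prod_window)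
    have "(\<Sum>k<L. \<eta> k \<bullet> \<psi> (j + k)) + \<zeta> 0 \<bullet> Xi pos y j = 0" if j: "j < ?nc" for j
    proof -
      have delta: "(\<Sum>t<?nc. vec_index (unit_vec ?nc j) t *\<^sub>R g t) = g j"
        for g :: "nat \<Rightarrow> real^'s"
      proof -
        have "(\<Sum>t<?nc. vec_index (unit_vec ?nc j) t *\<^sub>R g t) = (\<Sum>t<?nc. if t = j then g t else 0)"
          using j by (intro sum.cong) auto
        then show ?thesis using j by simp
      qed
      have "scalar_prod c ((?U @\<^sub>r ?X) *\<^sub>v unit_vec ?nc j) = 0"
        using orth by simp
      then show ?thesis by (simp only: mult[OF unit_vec_carrier] prod delta add_0_right)
    qed
    from delay_chain_annihilator_eq_0[OF blocks total G chain pe this]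
    have "\<forall>k<L. \<eta> k = 0" "\<zeta> 0 = 0" by blast+
    then have "window \<eta> 0 L = window (\<lambda>_. 0 :: real^'r) 0 L"
      "window \<zeta> 0 1 = window (\<lambda>_. 0 :: real^'n) 0 1"
      by (simp_all add: window_eq_iff)
    then show "c = 0\<^sub>v ?nr"
      unfolding c_eq by (intro eq_vecI) (auto simp: window_def)
  qed
  then obtain \<alpha> where \<alpha>: "\<alpha> \<in> carrier_vec ?nc"
    and "(?U @\<^sub>r ?X) *\<^sub>v \<alpha> = window \<psi>' 0 L @\<^sub>v window (\<lambda>_. \<xi>') 0 1" by blast
  then have "(\<forall>k<L. (\<Sum>j<?nc. vec_index \<alpha> j *\<^sub>R \<psi> (j + k)) = \<psi>' k)
      \<and> (\<Sum>j<?nc. vec_index \<alpha> j *\<^sub>R Xi pos y j) = \<xi>'"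
    by (simp only: mult[OF \<alpha>] append_vec_eq[OF window_carrier window_carrier] window_eq_iff) simp
  then show ?thesis using \<alpha> by (intro bexI[of _ \<alpha>]) auto
qed

section \<open>Trajectories as superpositions of data\<close>

lemma Xi_linear_combination:
  "Xi pos (\<lambda>i l. \<Sum>j\<in>J. a j * y i (j + l)) k = (\<Sum>j\<in>J. a j *\<^sub>R Xi pos y (j + k))"
  by (simp add: Xi_def vec_eq_iff add.assoc)

theorem theorem2:
  fixes f :: "(real^'n) \<times> (real^'m) \<Rightarrow> real^'n"
    and h :: "real^'n \<Rightarrow> real^'m"
    and d :: "'m \<Rightarrow> nat"
    and utilde :: "real^'n \<Rightarrow> real^'m"
    and pos :: "'n \<Rightarrow> 'm \<times> nat"
    and T :: "real^'n \<Rightarrow> real^'n"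
    and \<Psi> :: "(real^'m) \<times> (real^'n) \<Rightarrow> real^'r"
    and \<Omega> :: "((real^'m) \<times> (real^'n)) set"
    and G :: "real^'r^'m"
    and u ubar :: "nat \<Rightarrow> real^'m"
    and y ybar :: "'m \<Rightarrow> nat \<Rightarrow> real"
    and N L :: nat
  assumes analytic: "real_analytic f" "real_analytic h"
    and equilibrium: "f (0, 0) = 0" "h 0 = 0"
    and rel_degree: "\<forall>i. relative_degree f h i (d i)"
    and assumption1: "\<forall>x i. Phi_tilde f h d (utilde x) x $ i = 0"
    and assumption2: "\<forall>x. rank (decoupling_matrix f h d x (utilde x)) = CARD('m)"
    and assumption3: "(\<Sum>i\<in>UNIV. d i) = CARD('n)"
    and pos: "block_enumeration d pos"
    and T: "coordinate_transformation f h pos T"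
    and basis_functions: "\<forall>i. locally_lipschitz (\<lambda>z. \<Psi> z $ i)" "components_linearly_independent \<Psi>"
    and Omega: "compact \<Omega>"
    and G: "best_approximation \<Omega> (Phi f h d T) \<Psi> G"
    and assumption4: "rank G = CARD('m)"
    and nominal: "\<forall>z. approx_error (Phi f h d T) G \<Psi> z = 0"
    and data: "trajectory f h d N u y"
    and excitation: "persistently_exciting (L + CARD('n)) N (\<lambda>k. \<Psi> (u k, Xi pos y k))"
  shows "trajectory f h d L ubar ybar \<longleftrightarrow>
    (\<exists>\<alpha> \<in> carrier_vec (N + 1 - L).
      (hankel L N (\<lambda>k. \<Psi> (u k, Xi pos y k)) @\<^sub>r hankel (L + 1) (N + 1) (Xi pos y)) *\<^sub>v \<alpha>
        = window (\<lambda>k. \<Psi> (ubar k, Xi pos ybar k)) 0 L @\<^sub>v window (Xi pos ybar) 0 (L + 1))"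
proof -
  let ?\<psi> = "\<lambda>k. \<Psi> (u k, Xi pos y k)" and ?\<psi>' = "\<lambda>k. \<Psi> (ubar k, Xi pos ybar k)"
  let ?nc = "N + 1 - L"
  note recursion = trajectory_iff_recursion[OF rel_degree pos T nominal]
  have chain: "\<forall>k<N. \<forall>i. y i (k + d i) = (G *v ?\<psi> k) $ i"
    using data by (simp only: recursion)
  \<comment> \<open>The superposed outputs; the lower rows of the matrix equation compare them with \<open>ybar\<close>. Their
    recursion has the superposed values of \<open>\<Psi>\<close>, which need not be values of \<open>\<Psi>\<close>.\<close>
  define Y where "Y \<alpha> i l = (\<Sum>j<?nc. vec_index \<alpha> j * y i (j + l))" for \<alpha> i l
  have Xi_Y: "Xi pos (Y \<alpha>) k = (\<Sum>j<?nc. vec_index \<alpha> j *\<^sub>R Xi pos y (j + k))" for \<alpha> k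
    unfolding Y_def by (rule Xi_linear_combination)
  have Y_rec: "Y \<alpha> i (k + d i) = (G *v (\<Sum>j<?nc. vec_index \<alpha> j *\<^sub>R ?\<psi> (j + k))) $ i"
    if "k < L" for \<alpha> i k
  proof -
    have "y i (j + (k + d i)) = (G *v ?\<psi> (j + k)) $ i" if "j < ?nc" for j
      using chain[rule_format, of "j + k" i] that \<open>k < L\<close> by (simp add: add.assoc)
    then show ?thesis
      by (simp add: Y_def linear_sum[OF matrix_vector_mul_linear] matrix_vector_mult_scaleR)
  qed
  have equations: "(hankel L N ?\<psi> @\<^sub>r hankel (L + 1) (N + 1) (Xi pos y)) *\<^sub>v \<alpha>
        = window ?\<psi>' 0 L @\<^sub>v window (Xi pos ybar) 0 (L + 1) \<longleftrightarrow>
      (\<forall>k<L. ?\<psi>' k = (\<Sum>j<?nc. vec_index \<alpha> j *\<^sub>R ?\<psi> (j + k))) \<and>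
      (\<forall>k\<le>L. Xi pos ybar k = Xi pos (Y \<alpha>) k)" if \<alpha>: "\<alpha> \<in> carrier_vec ?nc" for \<alpha>
  proof -
    have "(hankel L N ?\<psi> @\<^sub>r hankel (L + 1) (N + 1) (Xi pos y)) *\<^sub>v \<alpha>
        = window (\<lambda>k. \<Sum>j<?nc. vec_index \<alpha> j *\<^sub>R ?\<psi> (j + k)) 0 L @\<^sub>v window (Xi pos (Y \<alpha>)) 0 (L + 1)"
      unfolding Xi_Y[abs_def] by (rule stacked_hankel_mult_vec[OF _ \<alpha>]) simp
    then show ?thesis
      by (auto simp: append_vec_eq[OF window_carrier window_carrier] window_eq_iff less_Suc_eq_le)
  qed
  show ?thesis
  proof
    assume "trajectory f h d L ubar ybar"
    then have chain': "\<forall>k<L. \<forall>i. ybar i (k + d i) = (G *v ?\<psi>' k) $ i"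
      by (simp only: recursion)
    obtain \<alpha> where \<alpha>: "\<alpha> \<in> carrier_vec ?nc"
      and \<psi>': "\<And>k. k < L \<Longrightarrow> ?\<psi>' k = (\<Sum>j<?nc. vec_index \<alpha> j *\<^sub>R ?\<psi> (j + k))"
      and init: "Xi pos ybar 0 = (\<Sum>j<?nc. vec_index \<alpha> j *\<^sub>R Xi pos y j)"
      using delay_chain_data_span[OF pos assumption3 assumption4 chain excitation,
            where \<psi>' = ?\<psi>' and \<xi>' = "Xi pos ybar 0"] by blast
    have "Xi pos ybar k = Xi pos (Y \<alpha>) k" if "k \<le> L" for k
      using pos _ _ that
    proof (rule Xi_unique)
      show "Xi pos ybar 0 = Xi pos (Y \<alpha>) 0" by (simp add: init Xi_Y)
      show "ybar i (k + d i) = Y \<alpha> i (k + d i)" if "k < L" for k i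
        using chain' that by (simp only: Y_rec \<psi>'[symmetric])
    qed
    then have "(hankel L N ?\<psi> @\<^sub>r hankel (L + 1) (N + 1) (Xi pos y)) *\<^sub>v \<alpha>
        = window ?\<psi>' 0 L @\<^sub>v window (Xi pos ybar) 0 (L + 1)"
      unfolding equations[OF \<alpha>] using \<psi>' by blast
    then show "\<exists>\<alpha>\<in>carrier_vec ?nc. (hankel L N ?\<psi> @\<^sub>r hankel (L + 1) (N + 1) (Xi pos y)) *\<^sub>v \<alpha>
        = window ?\<psi>' 0 L @\<^sub>v window (Xi pos ybar) 0 (L + 1)"
      using \<alpha> by (rule bexI)
  next
    assume "\<exists>\<alpha>\<in>carrier_vec ?nc. (hankel L N ?\<psi> @\<^sub>r hankel (L + 1) (N + 1) (Xi pos y)) *\<^sub>v \<alpha>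
        = window ?\<psi>' 0 L @\<^sub>v window (Xi pos ybar) 0 (L + 1)"
    then obtain \<alpha> where \<psi>': "\<And>k. k < L \<Longrightarrow> ?\<psi>' k = (\<Sum>j<?nc. vec_index \<alpha> j *\<^sub>R ?\<psi> (j + k))"
      and Xi: "\<And>k. k \<le> L \<Longrightarrow> Xi pos ybar k = Xi pos (Y \<alpha>) k"
      using equations by blast
    have "ybar i (k + d i) = (G *v ?\<psi>' k) $ i" if k: "k < L" for k i
    proof -
      have "1 \<le> d i" using rel_degree by (simp add: relative_degree_def)
      \<comment> \<open>The output at time \<open>k + d i\<close> is the last entry of the \<open>i\<close>-th block of \<open>\<Xi>\<close> at time \<open>k + 1\<close>.\<close>
      then have "ybar i (k + d i) = Y \<alpha> i (k + d i)"
        using Xi_eqD[OF pos Xi, where k = "Suc k" and l = "d i - 1" and i = i] k by simp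
      then show ?thesis by (simp only: Y_rec[OF k] \<psi>'[OF k])
    qed
    then show "trajectory f h d L ubar ybar" by (simp only: recursion) blast
  qed
qed

end
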